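(* Let $\mathcal{L}_1,\mathcal{L}_2,\mathcal{L}_3,\mathcal{L}_4$ be four $n$-pencils in the real projective plane whose four centres do not all lie on a single line. Let $P$ be the set of $4$-rich points determined by these four pencils. Then $|P| = O(n^{11/6})$, where the implied constant is absolute.
   Context: An $n$-pencil with centre $p \in P^2(\mathbb{R})$ is a set of $n$ distinct concurrent lines all passing through $p$. Given $m$ pencils, a point is called $m$-rich if it lies on at least one line from each of the $m$ pencils (so for four pencils, a $4$-rich point is a point lying on a line of each of the four pencils).
   Formalization: The four centres are assumed pairwise distinct, which the statement leaves implicit; if two pencils may share a centre the bound fails (two equal pencils and three noncollinear centres can give order n^2 rich points). *)

theory Defs
  imports "HOL-Analysis.Analysis"
begin

text \<open>
  The real projective plane, modelled as usual by the subspaces of \<open>real ^ 3\<close>: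
  its points are the 1-dimensional and its lines the 2-dimensional linear subspaces,
  and the point \<open>p\<close> lies on the line \<open>l\<close> iff \<open>p \<subseteq> l\<close>.
\<close>

definition proj_points :: "(real ^ 3) set set" where
  "proj_points = {p. subspace p \<and> dim p = 1}"

definition proj_lines :: "(real ^ 3) set set" where
  "proj_lines = {l. subspace l \<and> dim l = 2}"

definition proj_collinear :: "(real ^ 3) set set \<Rightarrow> bool" where
  "proj_collinear S \<longleftrightarrow> (\<exists>l \<in> proj_lines. \<forall>p \<in> S. p \<subseteq> l)"

definition n_pencil :: "nat \<Rightarrow> (real ^ 3) set \<Rightarrow> (real ^ 3) set set \<Rightarrow> bool" where
  "n_pencil n c L \<longleftrightarrow>
     c \<in> proj_points \<and> L \<subseteq> proj_lines \<and> finite L \<and> card L = n \<and> (\<forall>l \<in> L. c \<subseteq> l)"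

text \<open>For a family of pencils indexed by a set of \<open>m\<close> indices, these are the \<open>m\<close>-rich points.\<close>

definition rich_points :: "'i set \<Rightarrow> ('i \<Rightarrow> (real ^ 3) set set) \<Rightarrow> (real ^ 3) set set" where
  "rich_points I L = {x \<in> proj_points. \<forall>i \<in> I. \<exists>l \<in> L i. x \<subseteq> l}"

end

theory Submission
  imports Defs
begin

text \<open>
  Consider pairs \<open>(x, y)\<close> of rich points on a common line of the first pencil. Projecting
  along the line of the second pencil through \<open>x\<close> and then along the one through \<open>y\<close> takes
  the line of the third pencil through \<open>x\<close> to the line of the fourth pencil through \<open>y\<close>. All these
  projectivities send the line joining the second and third centre to the line joining the second
  and fourth, so in suitable parameters they are affine, and the pairs become
  incidences between \<open>n\<^sup>2\<close> lines and an \<open>n \<times> n\<close> grid. By Cauchy-Schwarz there are at least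
  \<open>|P|\<^sup>2 / n\<close> of them. The Szemeredi-Trotter bound \<open>O(n\<^bsup>8/3\<^esup>)\<close> has an elementary proof
  for grids: cut the grid into cells, note that a line meets few cells, and count pairs of grid points
  in the same row and column of cells.
\<close>

section \<open>Incidences between lines and a grid\<close>

text \<open>Keep the least element of each fibre of \<open>h\<close>. Any other element of
  \<open>S\<close> is the larger member of a colliding pair.\<close>

lemma card_le_image_plus_collisions:
  fixes S :: "'a::linorder set"
  assumes "finite S"
  shows "card S \<le> card (h ` S) + card {(x, y). x \<in> S \<and> y \<in> S \<and> x < y \<and> h x = h y}"
    (is "_ \<le> _ + card ?P")
proof -
  define M where "M = {x \<in> S. \<forall>y\<in>S. h y = h x \<longrightarrow> x \<le> y}"
  have finP: "finite ?P"
    by (rule finite_subset[of _ "S \<times> S"]) (use assms in auto)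
  have "S \<subseteq> M \<union> snd ` ?P"
    unfolding M_def by force
  then have "card S \<le> card M + card (snd ` ?P)"
    using assms finP by (metis (no_types, lifting) M_def card_Un_le card_mono dual_order.trans
        finite_Un finite_imageI finite_subset mem_Collect_eq subsetI)
  moreover have "card M \<le> card (h ` S)"
  proof (rule card_inj_on_le[of h])
    show "inj_on h M"
      unfolding M_def inj_on_def by (auto intro: order_antisym)
  qed (use assms in \<open>auto simp: M_def\<close>)
  moreover have "card (snd ` ?P) \<le> card ?P"
    using finP by (rule card_image_le)
  ultimately show ?thesis by linarith
qed

text \<open>Cuts the line into intervals containing at most \<open>m\<close> points of \<open>U\<close> each.\<close>

definition cell :: "real set \<Rightarrow> nat \<Rightarrow> real \<Rightarrow> nat" where
  "cell U m x = card {u \<in> U. u < x} div m"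

lemma cell_mono:
  assumes "finite U" "x \<le> y"
  shows "cell U m x \<le> cell U m y"
  unfolding cell_def using assms by (intro div_le_mono card_mono) auto

lemma cell_le:
  assumes "finite U" "card U \<le> n"
  shows "cell U m x \<le> n div m"
proof -
  have "card {u \<in> U. u < x} \<le> card U"
    using assms by (intro card_mono) auto
  then show ?thesis
    unfolding cell_def using assms by (intro div_le_mono) simp
qed

text \<open>The rank in \<open>U\<close> is injective on \<open>U\<close>, and the ranks of the
  points of one cell lie in a block of \<open>m\<close> consecutive integers.\<close>

lemma card_cell_le:
  assumes "finite U" "m > 0"
  shows "card {x \<in> U. cell U m x = t} \<le> m"
proof -
  let ?r = "\<lambda>x. card {u \<in> U. u < x}"
  have "inj_on ?r U"
  proof (rule linorder_inj_onI)
    fix x y assume "x < y" "x \<in> U" "y \<in> U"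
    then have "{u \<in> U. u < x} \<subset> {u \<in> U. u < y}" by auto
    then have "?r x < ?r y"
      using assms by (intro psubset_card_mono) auto
    then show "?r x \<noteq> ?r y" by simp
  qed auto
  moreover have "?r ` {x \<in> U. cell U m x = t} \<subseteq> {t * m..<t * m + m}"
    using div_times_less_eq_dividend[of _ m] dividend_less_div_times[OF assms(2)]
    by (auto simp: cell_def add.commute)
  ultimately have "card {x \<in> U. cell U m x = t} \<le> card {t * m..<t * m + m}"
    by (intro card_inj_on_le[of ?r]) (auto intro: inj_on_subset)
  then show ?thesis by simp
qed

lemma card_cell_pairs_le:
  assumes "finite U" "card U \<le> n" "m > 0"
  shows "card {(x, y). x \<in> U \<and> y \<in> U \<and> cell U m x = cell U m y} \<le> n * m"
proof -
  have "{(x, y). x \<in> U \<and> y \<in> U \<and> cell U m x = cell U m y}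
      = Sigma U (\<lambda>x. {y \<in> U. cell U m y = cell U m x})"
    by auto
  then have "card {(x, y). x \<in> U \<and> y \<in> U \<and> cell U m x = cell U m y}
      = (\<Sum>x\<in>U. card {y \<in> U. cell U m y = cell U m x})"
    using assms by simp
  also have "\<dots> \<le> card U * m"
    using sum_bounded_above[of U "\<lambda>x. card {y \<in> U. cell U m y = cell U m x}" m]
      card_cell_le[OF assms(1,3)] by simp
  also have "\<dots> \<le> n * m"
    using assms by simp
  finally show ?thesis .
qed

text \<open>A line meets few cells because the cells it meets form a chain for one of the two
  orders on \<open>\<nat> \<times> \<nat>\<close> that are monotone in the first coordinate.\<close>

lemma card_cells_on_line_le:
  assumes "finite U" "card U \<le> n" "finite V" "card V \<le> n"
  shows "card ((\<lambda>x. (cell U m x, cell V m (a * x + b))) ` S) \<le> 2 * (n div m) + 1"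
    (is "card (?h ` S) \<le> 2 * ?k + 1")
proof -
  \<comment> \<open>For a falling line the second index is reversed, so both summands are
    non-decreasing along the line. Equal sums then force equal cells. The subtraction never
    truncates, since cell indices are at most \<open>?k\<close>.\<close>
  define s where "s = (\<lambda>(i, j). if a \<ge> 0 then i + j else i + (?k - j))"
  have le: "cell U m x \<le> ?k" "cell V m y \<le> ?k" for x y
    using assms by (auto intro: cell_le)
  have eq: "?h x = ?h y" if "x \<le> y" "s (?h x) = s (?h y)" for x y
  proof -
    have 1: "cell U m x \<le> cell U m y"
      using assms that by (intro cell_mono)
    show ?thesis
    proof (cases "a \<ge> 0")
      case True
      then have "cell V m (a * x + b) \<le> cell V m (a * y + b)"
        using assms that by (intro cell_mono) (auto intro: mult_left_mono)
      then show ?thesis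
        using 1 that True by (auto simp: s_def)
    next
      case False
      then have "cell V m (a * y + b) \<le> cell V m (a * x + b)"
        using assms that by (intro cell_mono) (auto intro: mult_left_mono_neg)
      then show ?thesis
        using 1 that False le(2)[of "a * x + b"] le(2)[of "a * y + b"] by (auto simp: s_def)
    qed
  qed
  have "inj_on s (?h ` S)"
  proof (rule inj_onI)
    fix p q assume "p \<in> ?h ` S" "q \<in> ?h ` S" "s p = s q"
    then obtain x y where "p = ?h x" "q = ?h y" by blast
    with \<open>s p = s q\<close> show "p = q"
      using eq[of x y] eq[of y x] by (metis linorder_le_cases)
  qed
  moreover have "s ` ?h ` S \<subseteq> {..2 * ?k}"
  proof clarify
    fix x
    show "s (?h x) \<le> 2 * ?k"
      using le(1)[of x] le(2)[of "a * x + b"] by (auto simp: s_def)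
  qed
  ultimately have "card (?h ` S) \<le> card {..2 * ?k}"
    by (intro card_inj_on_le[of s]) auto
  then show ?thesis by simp
qed

text \<open>On each line, the incidences number at most the cells met plus the pairs of incidences
  sharing a cell. The first term is small for every line; the second is bounded only after summing
  over all lines, because two points determine a line.\<close>

lemma grid_incidences_le:
  fixes U V :: "real set" and F :: "(real \<times> real) set"
  assumes U: "finite U" "card U \<le> n" and V: "finite V" "card V \<le> n"
    and F: "finite F" and m: "m > 0"
  shows "card (Sigma F (\<lambda>(a, b). {x \<in> U. a * x + b \<in> V}))
    \<le> card F * (2 * (n div m) + 1) + (n * m)\<^sup>2"
proof -
  define S where "S = (\<lambda>(a, b). {x \<in> U. a * x + b \<in> V})"
  define h where "h = (\<lambda>(a, b) x. (cell U m x, cell V m (a * x + b)))"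
  define P where "P = (\<lambda>p. {(x, y). x \<in> S p \<and> y \<in> S p \<and> x < y \<and> h p x = h p y})"
  \<comment> \<open>The diagonal and both orders are kept: along a line the second coordinates of a
    pair may coincide or decrease.\<close>
  define E where "E = (\<lambda>W. {(x, y). x \<in> W \<and> y \<in> W \<and> cell W m x = cell W m y})"
  have finS: "finite (S p)" for p
    using U by (cases p) (auto simp: S_def)
  have finP: "finite (P p)" for p
    by (rule finite_subset[of _ "S p \<times> S p"]) (use finS in \<open>auto simp: P_def\<close>)
  have finE: "finite (E W)" if "finite W" for W
    by (rule finite_subset[of _ "W \<times> W"]) (use that in \<open>auto simp: E_def\<close>)
  have one: "card (S p) \<le> (2 * (n div m) + 1) + card (P p)" for p
  proof -
    obtain a b where p: "p = (a, b)" by (cases p)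
    have "card (h p ` S p) \<le> 2 * (n div m) + 1"
      using card_cells_on_line_le[OF U V] unfolding h_def p by simp
    with card_le_image_plus_collisions[OF finS[of p], of "h p"] show ?thesis
      unfolding P_def by linarith
  qed
  \<comment> \<open>\<open>g\<close> lists the coordinates of the two grid points of a collision.
    Their abscissae differ, so they determine slope and intercept.\<close>
  define g where "g = (\<lambda>((a, b), x, y). ((x, y), (a * x + b, a * y + b :: real)))"
  have inj: "inj_on g (Sigma F P)"
  proof (rule inj_onI)
    fix p q assume "p \<in> Sigma F P" "q \<in> Sigma F P" "g p = g q"
    moreover obtain a b x y where p: "p = ((a, b), x, y)" by (metis prod.collapse)
    moreover obtain a' b' x' y' where q: "q = ((a', b'), x', y')" by (metis prod.collapse)
    ultimately have eq: "x = x'" "y = y'" "a * x + b = a' * x + b'" "a * y + b = a' * y + b'"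
      and "x < y" by (auto simp: g_def P_def)
    have "(a - a') * (x - y) = 0"
      using eq by (simp add: algebra_simps)
    then have "a = a'" using \<open>x < y\<close> by simp
    then show "p = q" using eq p q by simp
  qed
  have "g ` Sigma F P \<subseteq> E U \<times> E V"
    by (auto simp: g_def P_def E_def S_def h_def)
  then have "card (Sigma F P) \<le> card (E U \<times> E V)"
    using inj finE U V by (intro card_inj_on_le[of g]) auto
  also have "\<dots> \<le> (n * m) * (n * m)"
    unfolding card_cartesian_product E_def
    using card_cell_pairs_le U V m by (intro mult_le_mono) auto
  finally have P: "card (Sigma F P) \<le> (n * m)\<^sup>2"
    by (simp add: power2_eq_square)
  have "card (Sigma F S) = (\<Sum>p\<in>F. card (S p))"
    using F finS by simp
  also have "\<dots> \<le> (\<Sum>p\<in>F. (2 * (n div m) + 1) + card (P p))"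
    using one by (intro sum_mono)
  also have "\<dots> = card F * (2 * (n div m) + 1) + card (Sigma F P)"
    using F finP by (simp only: sum.distrib sum_constant card_SigmaI of_nat_id) simp
  finally show ?thesis
    using P unfolding S_def by linarith
qed

text \<open>The Szemeredi-Trotter exponent for about n^2 points and n^2 lines: (n^2 * n^2)^(2/3) =
  n^(8/3).\<close>

lemma grid_incidences_bound:
  fixes U V :: "real set" and F :: "(real \<times> real) set"
  assumes U: "finite U" "card U \<le> n" and V: "finite V" "card V \<le> n"
    and F: "finite F" "card F \<le> n\<^sup>2" and n: "n > 0"
  shows "real (card (Sigma F (\<lambda>(a, b). {x \<in> U. a * x + b \<in> V}))) \<le> 7 * real n powr (8 / 3)"
proof -
  define t where "t = real n powr (1 / 3)"
  have t1: "t \<ge> 1"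
    unfolding t_def using n by (intro ge_one_powr_ge_zero) auto
  have t3: "real n = t ^ 3"
    unfolding t_def using n by (simp add: powr_powr flip: powr_realpow)
  \<comment> \<open>Cell size about n^(1/3) balances n^2 * (n / m) against (n m)^2. With n = t^3 the
    two terms are at most 3 t^8 and 4 t^8, the latter from \<open>m\<close> being at most
    \<open>2 * t\<close>.\<close>
  define m where "m = nat \<lceil>t\<rceil>"
  have m: "m > 0" "t \<le> real m" "real m \<le> 2 * t"
    unfolding m_def using t1 by linarith+
  have "real (n div m) \<le> real n / real m"
    by (simp add: of_nat_div_le_of_nat)
  also have "\<dots> \<le> real n / t"
    using m t1 by (intro divide_left_mono) auto
  also have "\<dots> = t\<^sup>2"
    using t1 by (simp add: t3 power2_eq_square power3_eq_cube)
  finally have k: "real (n div m) \<le> t\<^sup>2" .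
  have t2: "1 \<le> t\<^sup>2" using t1 by simp
  let ?I = "card (Sigma F (\<lambda>(a, b). {x \<in> U. a * x + b \<in> V}))"
  have "real ?I \<le> real (card F * (2 * (n div m) + 1) + (n * m)\<^sup>2)"
    using grid_incidences_le[OF U V F(1) m(1)] by (simp only: of_nat_le_iff)
  also have "\<dots> = real (card F) * (2 * real (n div m) + 1) + (real n * real m)\<^sup>2"
    by (simp add: algebra_simps)
  also have "\<dots> \<le> (real n)\<^sup>2 * (3 * t\<^sup>2) + (real n * (2 * t))\<^sup>2"
  proof (intro add_mono mult_mono power_mono)
    show "real (card F) \<le> (real n)\<^sup>2"
      using F(2) by (simp flip: of_nat_power)
    show "2 * real (n div m) + 1 \<le> 3 * t\<^sup>2"
      using k t2 by linarith
  qed (use m t1 in auto)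
  also have "\<dots> = 7 * t ^ 8"
    unfolding t3 by algebra
  also have "t ^ 8 = real n powr (8 / 3)"
    using n by (simp add: t_def powr_powr flip: powr_realpow)
  finally show ?thesis .
qed

section \<open>Collision counting and Elekes' incidence argument\<close>

text \<open>Cauchy-Schwarz for the fibre sizes: they sum to \<open>card Q\<close>, and their squares
  sum to the number of ordered pairs inside fibres, diagonal included.\<close>

lemma card_square_le_collisions:
  assumes "finite Q" "card (f ` Q) \<le> n"
  shows "(card Q)\<^sup>2 \<le> n * card {(x, y). x \<in> Q \<and> y \<in> Q \<and> f x = f y}"
proof -
  define q where "q = (\<lambda>t. card {x \<in> Q. f x = t})"
  have Q: "card Q = (\<Sum>t\<in>f ` Q. q t)"
    unfolding q_def using sum.image_gen[OF assms(1), of "\<lambda>_. 1::nat" f] by simp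
  have "{(x, y). x \<in> Q \<and> y \<in> Q \<and> f x = f y} = Sigma Q (\<lambda>x. {y \<in> Q. f y = f x})"
    by auto
  then have "card {(x, y). x \<in> Q \<and> y \<in> Q \<and> f x = f y} = (\<Sum>x\<in>Q. q (f x))"
    unfolding q_def using assms by simp
  also have "\<dots> = (\<Sum>t\<in>f ` Q. (q t)\<^sup>2)"
    by (subst sum.image_gen[OF assms(1), of _ f]) (simp add: q_def power2_eq_square)
  finally have P: "card {(x, y). x \<in> Q \<and> y \<in> Q \<and> f x = f y} = (\<Sum>t\<in>f ` Q. (q t)\<^sup>2)" .
  have "(\<Sum>t\<in>f ` Q. real (q t))\<^sup>2 \<le> real (card (f ` Q)) * (\<Sum>t\<in>f ` Q. (real (q t))\<^sup>2)"
    using Cauchy_Schwarz_ineq_sum[of "\<lambda>_. 1" "\<lambda>t. real (q t)" "f ` Q"] by simp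
  then have "real ((card Q)\<^sup>2) \<le> real (card (f ` Q) * (\<Sum>t\<in>f ` Q. (q t)\<^sup>2))"
    unfolding Q by simp
  then have "(card Q)\<^sup>2 \<le> card (f ` Q) * (\<Sum>t\<in>f ` Q. (q t)\<^sup>2)"
    by (simp only: of_nat_le_iff)
  also have "\<dots> \<le> n * (\<Sum>t\<in>f ` Q. (q t)\<^sup>2)"
    using assms by simp
  finally show ?thesis unfolding P .
qed

text \<open>Elekes' argument: a pair \<open>x, y\<close> in the same fibre of \<open>f1\<close> is an incidence between
  the line indexed by \<open>(f2 x, f2 y)\<close> and the grid point \<open>(f3 x, f4 y)\<close>.\<close>

lemma elekes_bound:
  fixes f3 f4 :: "'a \<Rightarrow> real" and f2 :: "'a \<Rightarrow> 'b"
  assumes Q: "finite Q" and n: "n > 0"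
    and card: "card (f1 ` Q) \<le> n" "card (f2 ` Q) \<le> n" "card (f3 ` Q) \<le> n" "card (f4 ` Q) \<le> n"
    and inj12: "inj_on (\<lambda>x. (f1 x, f2 x)) Q" and inj23: "inj_on (\<lambda>x. (f2 x, f3 x)) Q"
    and line: "\<And>x y. x \<in> Q \<Longrightarrow> y \<in> Q \<Longrightarrow> f1 x = f1 y \<Longrightarrow>
      f4 y = fst (G (f2 x, f2 y)) * f3 x + snd (G (f2 x, f2 y))"
    and injG: "inj_on G (f2 ` Q \<times> f2 ` Q)"
  shows "real (card Q) \<le> 3 * real n powr (11 / 6)"
proof -
  define P where "P = {(x, y). x \<in> Q \<and> y \<in> Q \<and> f1 x = f1 y}"
  define F where "F = G ` (f2 ` Q \<times> f2 ` Q)"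
  let ?I = "Sigma F (\<lambda>(a, b). {u \<in> f3 ` Q. a * u + b \<in> f4 ` Q})"
  have F: "finite F" "card F \<le> n\<^sup>2"
  proof -
    show "finite F" unfolding F_def using Q by simp
    have "card F \<le> card (f2 ` Q \<times> f2 ` Q)"
      unfolding F_def using Q by (intro card_image_le) auto
    also have "\<dots> \<le> n * n"
      unfolding card_cartesian_product using card by (intro mult_le_mono)
    finally show "card F \<le> n\<^sup>2" by (simp add: power2_eq_square)
  qed
  define g where "g = (\<lambda>(x, y). (G (f2 x, f2 y), f3 x))"
  \<comment> \<open>The line yields \<open>f2 x\<close> and \<open>f2 y\<close>; adding
    \<open>f3 x\<close> yields \<open>x\<close>. Then \<open>f1 y = f1 x\<close> together with
    \<open>f2 y\<close> yields \<open>y\<close>.\<close>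
  have "inj_on g P"
  proof (rule inj_onI)
    fix p q assume pq: "p \<in> P" "q \<in> P" "g p = g q"
    obtain x y where p: "p = (x, y)" by (cases p)
    obtain x' y' where q: "q = (x', y')" by (cases q)
    have Qs: "x \<in> Q" "y \<in> Q" "x' \<in> Q" "y' \<in> Q" "f1 x = f1 y" "f1 x' = f1 y'"
      and eq: "G (f2 x, f2 y) = G (f2 x', f2 y')" "f3 x = f3 x'"
      using pq by (auto simp: p q P_def g_def)
    have "(f2 x, f2 y) = (f2 x', f2 y')"
      using inj_onD[OF injG eq(1)] Qs by simp
    then have "x = x'" "f2 y = f2 y'"
      using inj_onD[OF inj23, of x x'] Qs eq by auto
    then show "p = q"
      using inj_onD[OF inj12, of y y'] Qs p q by auto
  qed
  moreover have "g ` P \<subseteq> ?I"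
  proof (rule image_subsetI)
    fix p assume "p \<in> P"
    moreover obtain x y where p: "p = (x, y)" by (cases p)
    ultimately have xy: "x \<in> Q" "y \<in> Q" "f1 x = f1 y" by (auto simp: P_def)
    obtain a b where ab: "G (f2 x, f2 y) = (a, b)" by (cases "G (f2 x, f2 y)")
    have "a * f3 x + b = f4 y"
      using line[OF xy] ab by simp
    moreover have "(a, b) \<in> F"
      unfolding F_def using xy ab by (metis SigmaI imageI)
    ultimately show "g p \<in> ?I"
      using xy ab by (simp add: p g_def)
  qed
  moreover have "finite ?I"
    using F Q by (intro finite_SigmaI) auto
  ultimately have "card P \<le> card ?I"
    by (rule card_inj_on_le)
  moreover have "real (card ?I) \<le> 7 * real n powr (8 / 3)"
    using Q card F n by (intro grid_incidences_bound) auto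
  ultimately have P: "real (card P) \<le> 7 * real n powr (8 / 3)" by linarith
  have "real ((card Q)\<^sup>2) \<le> real (n * card P)"
    using card_square_le_collisions[OF Q card(1)] unfolding P_def by (simp only: of_nat_le_iff)
  then have "(real (card Q))\<^sup>2 \<le> real n * real (card P)" by simp
  \<comment> \<open>7 is weakened to 9 so that the square root is exact.\<close>
  moreover have "real n * real (card P) \<le> real n * (9 * real n powr (8 / 3))"
    using P by (intro mult_left_mono) auto
  moreover have "real n * (9 * real n powr (8 / 3)) = 9 * real n powr (11 / 6 + 11 / 6)"
  proof -
    have "real n * (9 * real n powr (8 / 3)) = 9 * real n powr (1 + 8 / 3)"
      using n unfolding powr_add by simp
    then show ?thesis by simp
  qed
  moreover have "9 * real n powr (11 / 6 + 11 / 6) = (3 * real n powr (11 / 6))\<^sup>2"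
    unfolding powr_add by (simp add: power2_eq_square)
  ultimately have "(real (card Q))\<^sup>2 \<le> (3 * real n powr (11 / 6))\<^sup>2" by linarith
  then show ?thesis
    by (rule power2_le_imp_le) simp
qed

section \<open>Projective points and lines through linear functionals\<close>

lemma proj_pointE:
  assumes "x \<in> proj_points"
  obtains v where "v \<noteq> 0" "x = span {v}"
proof -
  obtain b where b: "b \<subseteq> x" "independent b" "x \<subseteq> span b" "card b = dim x"
    using basis_exists[of x] by metis
  then obtain v where v: "b = {v}"
    using assms by (auto simp: proj_points_def card_1_singleton_iff)
  have "span b \<subseteq> x"
    using b assms by (intro span_minimal) (auto simp: proj_points_def)
  with b v have "x = span {v}" by blast
  moreover have "v \<noteq> 0"
    using b v dependent_zero by blast
  ultimately show ?thesis using that by blast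
qed

lemma pencil_line:
  assumes "n_pencil n (span {e}) L" "l \<in> L"
  shows "l \<in> proj_lines" "e \<in> l" "e \<noteq> 0"
proof -
  have "span {e} \<subseteq> l" "l \<in> proj_lines" "dim {e} = 1"
    using assms by (auto simp: n_pencil_def proj_points_def)
  then show "l \<in> proj_lines" "e \<in> l" "e \<noteq> 0"
    using span_base[of e "{e}"] by auto
qed

lemma span_pairE:
  fixes w :: "'a::real_vector"
  assumes "w \<in> span {u, v}"
  obtains s t where "w = s *\<^sub>R u + t *\<^sub>R v"
proof -
  obtain s t where "w - s *\<^sub>R u - t *\<^sub>R v = 0"
    using assms by (auto simp: span_breakdown_eq)
  then have "w = s *\<^sub>R u + t *\<^sub>R v" by (simp add: algebra_simps)
  then show ?thesis by (rule that)
qed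

lemma proj_line_eq_span:
  assumes l: "l \<in> proj_lines" "e \<in> l" "v \<in> l" and ev: "independent {e, v}" "e \<noteq> v"
  shows "l = span {e, v}"
proof -
  have "subspace l" "dim l = 2"
    using l by (auto simp: proj_lines_def)
  then have "span {e, v} \<subseteq> l"
    using l by (intro span_minimal) auto
  moreover have "dim (span {e, v}) = 2"
    using ev by (simp add: dim_eq_card_independent)
  ultimately show ?thesis
    using \<open>subspace l\<close> \<open>dim l = 2\<close> by (metis order_refl subspace_dim_equal subspace_span)
qed

lemma independent_pairI:
  fixes \<psi> :: "real ^ 3 \<Rightarrow> real"
  assumes "linear \<psi>" "\<psi> e = 0" "e \<noteq> 0" "\<psi> v \<noteq> 0"
  shows "independent {e, v}" "e \<noteq> v"
proof -
  have "v \<notin> span {e}"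
    using assms by (auto simp: span_singleton linear_scale)
  then show "independent {e, v}"
    using assms(3) by (simp add: independent_insert insert_commute[of e])
  show "e \<noteq> v" using assms by auto
qed

text \<open>Modulo \<open>e\<close> the vectors of \<open>l\<close> are multiples of
  \<open>v\<close>, and both functionals kill \<open>e\<close>, so they scale by the same factor.
  Hence such a ratio labels the lines of a pencil, whatever representative vector is chosen.\<close>

lemma ratio_eq_on_line:
  fixes \<phi> \<psi> :: "real ^ 3 \<Rightarrow> real"
  assumes lin: "linear \<phi>" "linear \<psi>" and e: "\<phi> e = 0" "\<psi> e = 0" "e \<noteq> 0"
    and l: "l \<in> proj_lines" "e \<in> l" "v \<in> l" "w \<in> l" and nz: "\<psi> v \<noteq> 0" "\<psi> w \<noteq> 0"
  shows "\<phi> v / \<psi> v = \<phi> w / \<psi> w"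
proof -
  have "l = span {e, v}"
    using independent_pairI[OF lin(2) e(2,3) nz(1)] l by (intro proj_line_eq_span)
  then obtain s t where "w = s *\<^sub>R e + t *\<^sub>R v"
    using l by (metis span_pairE)
  then have "\<phi> w = t * \<phi> v" "\<psi> w = t * \<psi> v"
    using lin e by (simp_all add: linear_add linear_scale)
  then show ?thesis using nz by auto
qed

text \<open>\<open>f\<close> factors through any choice of a line of \<open>L\<close> containing the
  point. It serves both for ratios of functionals and, with \<open>f\<close> the identity, for
  counting points.\<close>

lemma card_values_le:
  assumes L: "finite L" and ex: "\<And>x. x \<in> Q \<Longrightarrow> \<exists>l\<in>L. x \<subseteq> l"
    and const: "\<And>x y l. x \<in> Q \<Longrightarrow> y \<in> Q \<Longrightarrow> l \<in> L \<Longrightarrow> x \<subseteq> l \<Longrightarrow> y \<subseteq> l \<Longrightarrow> f x = f y"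
  shows "finite (f ` Q)" "card (f ` Q) \<le> card L"
proof -
  obtain k where k: "\<And>x. x \<in> Q \<Longrightarrow> k x \<in> L \<and> x \<subseteq> k x"
    using ex by metis
  define g where "g l = f (SOME x. x \<in> Q \<and> x \<subseteq> l)" for l
  have "f x = g (k x)" if "x \<in> Q" for x
    unfolding g_def by (rule someI2[of _ x]) (use k that const in blast)+
  then have "f ` Q \<subseteq> g ` L"
    using k by auto
  then show "finite (f ` Q)" "card (f ` Q) \<le> card L"
    using L by (auto intro: finite_surj surj_card_le)
qed

text \<open>The kernel of \<phi> is a projective line missing the centre, so each line of the pencil
  meets it in only one point.\<close>

lemma rich_points_on_line:
  fixes \<phi> :: "real ^ 3 \<Rightarrow> real"
  assumes pencil: "n_pencil n (span {e}) L" and lin: "linear \<phi>" and e: "\<phi> e \<noteq> 0"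
    and R: "R \<subseteq> proj_points" "\<And>x. x \<in> R \<Longrightarrow> \<exists>l\<in>L. x \<subseteq> l" "\<And>x v. x \<in> R \<Longrightarrow> v \<in> x \<Longrightarrow> \<phi> v = 0"
  shows "finite R" "card R \<le> n"
proof -
  have L: "finite L" "card L = n"
    using pencil by (auto simp: n_pencil_def)
  have eq: "x = y" if xy: "x \<in> R" "y \<in> R" "l \<in> L" "x \<subseteq> l" "y \<subseteq> l" for x y l
  proof -
    obtain v where v: "v \<noteq> 0" "x = span {v}"
      using R xy by (metis proj_pointE subsetD)
    obtain w where w: "w \<noteq> 0" "y = span {w}"
      using R xy by (metis proj_pointE subsetD)
    have vw: "v \<in> x" "w \<in> y"
      using v w by (auto intro: span_base)
    then have \<phi>: "\<phi> v = 0" "\<phi> w = 0"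
      using R xy by auto
    have l: "l \<in> proj_lines" "e \<in> l"
      using pencil_line[OF pencil] xy by auto
    have "l = span {v, e}"
      using independent_pairI[OF lin \<phi>(1) v(1) e] l vw xy by (intro proj_line_eq_span) auto
    then obtain s t where st: "w = s *\<^sub>R v + t *\<^sub>R e"
      using xy vw by (metis span_pairE subsetD)
    then have "t = 0"
      using \<phi> lin e by (simp add: linear_add linear_scale)
    then have "w = s *\<^sub>R v" "s \<noteq> 0"
      using st w by auto
    then show "x = y"
      using v w span_image_scale[of "{v}" "\<lambda>_. s"] by simp
  qed
  then show "finite R" "card R \<le> n"
    using card_values_le[where f = "\<lambda>x. x", OF L(1) R(2) eq] L(2) by simp_all
qed

text \<open>The dual basis. Distinctness is assumed separately because the set
  \<open>{u, v, w}\<close> collapses when vectors coincide.\<close>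

lemma coordinate_functionals:
  fixes u v w :: "real ^ 3"
  assumes ind: "independent {u, v, w}" and dist: "u \<noteq> v" "u \<noteq> w" "v \<noteq> w"
  obtains \<alpha> \<beta> \<gamma> :: "real ^ 3 \<Rightarrow> real"
  where "linear \<alpha>" "linear \<beta>" "linear \<gamma>"
    "\<alpha> u = 1" "\<alpha> v = 0" "\<alpha> w = 0"
    "\<beta> u = 0" "\<beta> v = 1" "\<beta> w = 0"
    "\<gamma> u = 0" "\<gamma> v = 0" "\<gamma> w = 1"
    "\<And>x. x = \<alpha> x *\<^sub>R u + \<beta> x *\<^sub>R v + \<gamma> x *\<^sub>R w"
proof -
  obtain \<alpha> where \<alpha>: "linear \<alpha>" "\<forall>x\<in>{u, v, w}. \<alpha> x = (if x = u then 1 else 0 :: real)"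
    using linear_independent_extend[OF ind, of "\<lambda>x. if x = u then 1 else 0"] by blast
  obtain \<beta> where \<beta>: "linear \<beta>" "\<forall>x\<in>{u, v, w}. \<beta> x = (if x = v then 1 else 0 :: real)"
    using linear_independent_extend[OF ind, of "\<lambda>x. if x = v then 1 else 0"] by blast
  obtain \<gamma> where \<gamma>: "linear \<gamma>" "\<forall>x\<in>{u, v, w}. \<gamma> x = (if x = w then 1 else 0 :: real)"
    using linear_independent_extend[OF ind, of "\<lambda>x. if x = w then 1 else 0"] by blast
  note lin = \<alpha>(1) \<beta>(1) \<gamma>(1)
  have val: "\<alpha> u = 1" "\<alpha> v = 0" "\<alpha> w = 0" "\<beta> u = 0" "\<beta> v = 1" "\<beta> w = 0"
    "\<gamma> u = 0" "\<gamma> v = 0" "\<gamma> w = 1"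
    using \<alpha>(2) \<beta>(2) \<gamma>(2) dist by auto
  have "dim {u, v, w} = DIM(real ^ 3)"
    using ind dist by (simp add: dim_eq_card_independent)
  then have full: "span {u, v, w} = UNIV"
    using dim_eq_full by blast
  have "x = \<alpha> x *\<^sub>R u + \<beta> x *\<^sub>R v + \<gamma> x *\<^sub>R w" for x
  proof -
    have "x \<in> span {u, v, w}" using full by simp
    then obtain k where "x - k *\<^sub>R u \<in> span {v, w}"
      by (auto simp: span_breakdown_eq[of _ u])
    then obtain s t where "x - k *\<^sub>R u = s *\<^sub>R v + t *\<^sub>R w"
      by (rule span_pairE)
    then have x: "x = k *\<^sub>R u + s *\<^sub>R v + t *\<^sub>R w"
      by (simp add: algebra_simps)
    have "\<alpha> x = k" "\<beta> x = s" "\<gamma> x = t"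
      unfolding x using lin val by (simp_all add: linear_add linear_scale)
    then show ?thesis using x by simp
  qed
  then show ?thesis using that lin val by blast
qed

section \<open>Rich points of four pencils\<close>

lemma rich_points_empty:
  assumes "n_pencil 0 p (L i)" "i \<in> I"
  shows "rich_points I L = {}"
proof -
  have "L i = {}"
    using assms by (auto simp: n_pencil_def)
  then show ?thesis
    using assms(2) unfolding rich_points_def by blast
qed

text \<open>In coordinates \<open>\<alpha>, \<beta>, \<gamma>\<close> with respect to the centres of the pencils \<open>i, j, k\<close>, the lines of
  the pencils \<open>i, j, k, m\<close> are level sets of the ratios \<open>\<beta> / \<gamma>\<close>, \<open>\<alpha> / \<gamma>\<close>, \<open>\<beta> / \<alpha>\<close> and
  \<open>(b \<alpha> - a \<beta>) / (c \<alpha> - a \<gamma>)\<close>. The denominators vanish on the lines that join the centre \<open>j\<close>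
  to the other three, which carry few rich points.\<close>

lemma rich_points_bound_coordinates:
  fixes e :: "'i \<Rightarrow> real ^ 3"
  assumes pencil: "\<And>s. s \<in> {i, j, k, m} \<Longrightarrow> n_pencil n (span {e s}) (L s)"
    and ind: "independent {e i, e j, e k}" and dist: "e i \<noteq> e j" "e i \<noteq> e k" "e j \<noteq> e k"
    and em: "e m = a *\<^sub>R e i + b *\<^sub>R e j + c *\<^sub>R e k" and a: "a \<noteq> 0" and b: "b \<noteq> 0"
  shows "finite (rich_points {i, j, k, m} L) \<and>
    real (card (rich_points {i, j, k, m} L)) \<le> 6 * real n powr (11 / 6)"
\<comment> \<open>For \<open>n = 0\<close> the bound is zero, so there must be no rich points at
  all.\<close>
proof (cases "n = 0")
  case True
  then have "rich_points {i, j, k, m} L = {}"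
    using pencil[of i] by (intro rich_points_empty[of _ L i]) auto
  then show ?thesis by simp
next
  case False
  then have n: "n > 0" by simp
  define R where "R = rich_points {i, j, k, m} L"
  have R: "R \<subseteq> proj_points" "\<And>x s. x \<in> R \<Longrightarrow> s \<in> {i, j, k, m} \<Longrightarrow> \<exists>l\<in>L s. x \<subseteq> l"
    unfolding R_def rich_points_def by blast+
  obtain \<alpha> \<beta> \<gamma> :: "real ^ 3 \<Rightarrow> real" where lin: "linear \<alpha>" "linear \<beta>" "linear \<gamma>"
    and \<alpha>: "\<alpha> (e i) = 1" "\<alpha> (e j) = 0" "\<alpha> (e k) = 0"
    and \<beta>: "\<beta> (e i) = 0" "\<beta> (e j) = 1" "\<beta> (e k) = 0"
    and \<gamma>: "\<gamma> (e i) = 0" "\<gamma> (e j) = 0" "\<gamma> (e k) = 1"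
    and coord: "\<And>x. x = \<alpha> x *\<^sub>R e i + \<beta> x *\<^sub>R e j + \<gamma> x *\<^sub>R e k"
    by (rule coordinate_functionals[OF ind dist]) blast
  have m: "\<alpha> (e m) = a" "\<beta> (e m) = b" "\<gamma> (e m) = c"
    unfolding em using lin \<alpha> \<beta> \<gamma> by (simp_all add: linear_add linear_scale)
  \<comment> \<open>The kernel of \<delta> is the line joining the centres \<open>j\<close> and
    \<open>m\<close>, and that of \<epsilon> the line joining \<open>k\<close> and \<open>m\<close>;
    both are nonzero because \<open>a\<close> is.\<close>
  define \<delta> where "\<delta> v = c * \<alpha> v - a * \<gamma> v" for v
  define \<epsilon> where "\<epsilon> v = b * \<alpha> v - a * \<beta> v" for v
  have lin': "linear \<delta>" "linear \<epsilon>"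
    unfolding \<delta>_def \<epsilon>_def using lin
    by (auto intro!: linearI simp: linear_add linear_scale algebra_simps)
  have m': "\<delta> (e m) = 0" "\<epsilon> (e m) = 0"
    unfolding \<delta>_def \<epsilon>_def m by simp_all
  have "\<exists>v. span {v} = x" if "x \<in> proj_points" for x
    using that by (rule proj_pointE) blast
  then obtain r where r: "\<And>x. x \<in> proj_points \<Longrightarrow> span {r x} = x"
    by metis
  have rx: "r x \<in> x" if "x \<in> R" for x
  proof -
    have "r x \<in> span {r x}" by (intro span_base) simp
    then show ?thesis using r[of x] R(1) that by auto
  qed
  define R1 where "R1 = {x \<in> R. \<forall>v\<in>x. \<alpha> v = 0}"
  define R2 where "R2 = {x \<in> R. \<forall>v\<in>x. \<gamma> v = 0}"
  define R3 where "R3 = {x \<in> R. \<forall>v\<in>x. \<delta> v = 0}"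
  define Q where "Q = {x \<in> R. \<alpha> (r x) \<noteq> 0 \<and> \<gamma> (r x) \<noteq> 0 \<and> \<delta> (r x) \<noteq> 0}"
  \<comment> \<open>The three exceptional lines join centre \<open>j\<close> to \<open>k\<close>,
    \<open>i\<close> and \<open>m\<close>. Each is counted with a pencil whose centre lies off it:
    \<open>i\<close>, \<open>k\<close> and \<open>k\<close> respectively.\<close>
  have R1: "finite R1" "card R1 \<le> n"
    by (rule rich_points_on_line[where e = "e i" and L = "L i" and \<phi> = \<alpha>],
        use pencil[of i] lin \<alpha> R in \<open>auto simp: R1_def\<close>)+
  have R2: "finite R2" "card R2 \<le> n"
    by (rule rich_points_on_line[where e = "e k" and L = "L k" and \<phi> = \<gamma>],
        use pencil[of k] lin \<gamma> R in \<open>auto simp: R2_def\<close>)+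
  have "\<delta> (e k) \<noteq> 0"
    using \<alpha> \<gamma> a by (simp add: \<delta>_def)
  then have R3: "finite R3" "card R3 \<le> n"
    by - (rule rich_points_on_line[where e = "e k" and L = "L k" and \<phi> = \<delta>],
        use pencil[of k] lin' R in \<open>auto simp: R3_def\<close>)+
  have cover: "R \<subseteq> R1 \<union> R2 \<union> R3 \<union> Q"
  proof
    fix x assume x: "x \<in> R"
    have "\<phi> v = 0" if "linear \<phi>" "\<phi> (r x) = 0" "v \<in> x" for \<phi> :: "real ^ 3 \<Rightarrow> real" and v
    proof -
      have "v \<in> span {r x}" using r[of x] R(1) x that by auto
      then show ?thesis using that by (auto simp: span_singleton linear_scale)
    qed
    then show "x \<in> R1 \<union> R2 \<union> R3 \<union> Q"
      using x lin lin' unfolding R1_def R2_def R3_def Q_def by blast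
  qed
  \<comment> \<open>Pencil \<open>i\<close> supplies the fibres, pencil \<open>j\<close> the
    projecting lines, and pencils \<open>m\<close> and \<open>k\<close> the two sides of the grid.
    \<open>f2\<close> and \<open>f1\<close> are affine coordinates in the chart where \<gamma> is
    1.\<close>
  define f1 where "f1 x = \<beta> (r x) / \<gamma> (r x)" for x
  define f2 where "f2 x = \<alpha> (r x) / \<gamma> (r x)" for x
  define f3 where "f3 x = \<epsilon> (r x) / \<delta> (r x)" for x
  define f4 where "f4 x = \<beta> (r x) / \<alpha> (r x)" for x
  have ratio_values: "finite ((\<lambda>x. \<phi> (r x) / \<psi> (r x)) ` Q)" "card ((\<lambda>x. \<phi> (r x) / \<psi> (r x)) ` Q) \<le> n"
    if s: "s \<in> {i, j, k, m}" and \<phi>: "linear \<phi>" "linear \<psi>" "\<phi> (e s) = 0" "\<psi> (e s) = 0"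
      and nz: "\<And>x. x \<in> Q \<Longrightarrow> \<psi> (r x) \<noteq> 0" for \<phi> \<psi> :: "real ^ 3 \<Rightarrow> real" and s
  proof -
    have eq: "\<phi> (r x) / \<psi> (r x) = \<phi> (r y) / \<psi> (r y)"
      if xy: "x \<in> Q" "y \<in> Q" "l \<in> L s" "x \<subseteq> l" "y \<subseteq> l" for x y l
    proof (rule ratio_eq_on_line[OF \<phi>])
      show "e s \<noteq> 0" "l \<in> proj_lines" "e s \<in> l"
        using pencil_line[OF pencil[OF s] xy(3)] by auto
      show "r x \<in> l" "r y \<in> l"
        using rx xy by (auto simp: Q_def)
      show "\<psi> (r x) \<noteq> 0" "\<psi> (r y) \<noteq> 0"
        using nz xy by auto
    qed
    have L: "finite (L s)" "card (L s) = n"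
      using pencil[OF s] by (auto simp: n_pencil_def)
    have ex: "\<exists>l\<in>L s. x \<subseteq> l" if "x \<in> Q" for x
      using R(2) s that by (auto simp: Q_def)
    show "finite ((\<lambda>x. \<phi> (r x) / \<psi> (r x)) ` Q)" "card ((\<lambda>x. \<phi> (r x) / \<psi> (r x)) ` Q) \<le> n"
      using card_values_le[where f = "\<lambda>x. \<phi> (r x) / \<psi> (r x)", OF L(1) ex eq] L(2) by simp_all
  qed
  have f1: "finite (f1 ` Q)" "card (f1 ` Q) \<le> n"
    unfolding f1_def using lin \<beta> \<gamma> by (intro ratio_values[of i]; auto simp: Q_def)+
  have f2: "finite (f2 ` Q)" "card (f2 ` Q) \<le> n"
    unfolding f2_def using lin \<alpha> \<gamma> by (intro ratio_values[of j]; auto simp: Q_def)+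
  have f3: "finite (f3 ` Q)" "card (f3 ` Q) \<le> n"
    unfolding f3_def using lin' m' by (intro ratio_values[of m]; auto simp: Q_def)+
  have f4: "finite (f4 ` Q)" "card (f4 ` Q) \<le> n"
    unfolding f4_def using lin \<alpha> \<beta> by (intro ratio_values[of k]; auto simp: Q_def)+
  have f2nz: "f2 x \<noteq> 0" "c * f2 x - a \<noteq> 0" if "x \<in> Q" for x
    using that by (auto simp: Q_def f2_def \<delta>_def field_simps)
  have f3_eq: "f3 x = (b * f2 x - a * f1 x) / (c * f2 x - a)" if "x \<in> Q" for x
  proof -
    let ?g = "\<gamma> (r x)"
    have g: "?g \<noteq> 0" using that by (simp add: Q_def)
    then have "\<epsilon> (r x) = ?g * (b * f2 x - a * f1 x)" "\<delta> (r x) = ?g * (c * f2 x - a)"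
      by (simp_all add: \<epsilon>_def \<delta>_def f1_def f2_def field_simps)
    then show ?thesis using g by (simp add: f3_def)
  qed
  have f1_eq: "f1 x = (b * f2 x - f3 x * (c * f2 x - a)) / a" if "x \<in> Q" for x
    using f3_eq[OF that] f2nz[OF that] a by (simp add: field_simps)
  have f4_eq: "f4 x = f1 x / f2 x" if "x \<in> Q" for x
    using that by (simp add: Q_def f4_def f1_def f2_def)
  have inj12: "inj_on (\<lambda>x. (f1 x, f2 x)) Q"
  proof (rule inj_onI)
    fix x y assume xy: "x \<in> Q" "y \<in> Q" "(f1 x, f2 x) = (f1 y, f2 y)"
    have span: "x = span {f2 x *\<^sub>R e i + f1 x *\<^sub>R e j + e k}" if "x \<in> Q" for x
    proof -
      let ?g = "\<gamma> (r x)" and ?u = "f2 x *\<^sub>R e i + f1 x *\<^sub>R e j + e k"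
      have g: "?g \<noteq> 0" using that by (simp add: Q_def)
      then have "r x = ?g *\<^sub>R ?u"
        using coord[of "r x"] by (simp add: f1_def f2_def scaleR_add_right)
      then show ?thesis
        using r[of x] R(1) that g span_image_scale[of "{?u}" "\<lambda>_. ?g"] by (auto simp: Q_def)
    qed
    show "x = y"
      using span[OF xy(1)] span[OF xy(2)] xy(3) by simp
  qed
  have inj23: "inj_on (\<lambda>x. (f2 x, f3 x)) Q"
    using inj12 f1_eq unfolding inj_on_def by simp
  have finQ: "finite Q"
  proof (rule inj_on_finite[OF inj12])
    show "(\<lambda>x. (f1 x, f2 x)) ` Q \<subseteq> f1 ` Q \<times> f2 ` Q" by auto
  qed (use f1 f2 in auto)
  \<comment> \<open>With \<open>s = f2 x\<close> and \<open>t = f2 y\<close>,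
    \<open>f4 y = f1 y / f2 y = f1 x / t\<close>. Expressing \<open>f1 x\<close> by \<open>s\<close>
    and \<open>f3 x\<close> gives this slope and intercept.\<close>
  define G where "G = (\<lambda>(s, t). ((a - c * s) / (a * t), b * s / (a * t)))"
  have "real (card Q) \<le> 3 * real n powr (11 / 6)"
  proof (rule elekes_bound[where G = G])
    fix x y assume xy: "x \<in> Q" "y \<in> Q" "f1 x = f1 y"
    have "f4 y = (b * f2 x - f3 x * (c * f2 x - a)) / a / f2 y"
      using f4_eq[OF xy(2)] f1_eq[OF xy(1)] xy(3) by simp
    also have "\<dots> = fst (G (f2 x, f2 y)) * f3 x + snd (G (f2 x, f2 y))"
      unfolding G_def using f2nz(1)[OF xy(2)] a by (simp add: field_simps)
    finally show "f4 y = fst (G (f2 x, f2 y)) * f3 x + snd (G (f2 x, f2 y))" .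
  next
    \<comment> \<open>Equal intercepts give \<open>s * t' = s' * t\<close>, using that
      \<open>b\<close> is nonzero. In the slope equation the terms with \<open>c\<close> then cancel
      and leave \<open>t = t'\<close>.\<close>
    show "inj_on G (f2 ` Q \<times> f2 ` Q)"
    proof (rule inj_onI)
      fix p q assume pq: "p \<in> f2 ` Q \<times> f2 ` Q" "q \<in> f2 ` Q \<times> f2 ` Q" "G p = G q"
      obtain s t where p: "p = (s, t)" by (cases p)
      obtain s' t' where q: "q = (s', t')" by (cases q)
      have nz: "t \<noteq> 0" "t' \<noteq> 0"
        using pq f2nz p q by auto
      have "(a - c * s) / (a * t) = (a - c * s') / (a * t')" "b * s / (a * t) = b * s' / (a * t')"
        using pq p q by (auto simp: G_def)
      then have 1: "(a - c * s) * t' = (a - c * s') * t" and 2: "s * t' = s' * t"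
        using nz a b by (auto simp: field_simps)
      have "a * t' - c * (s * t') = a * t - c * (s' * t)"
        using 1 by (simp add: algebra_simps)
      then have "t = t'" using 2 a by simp
      then show "p = q" using 2 nz p q by simp
    qed
  qed (use finQ n f1 f2 f3 f4 inj12 inj23 in auto)
  \<comment> \<open>The exceptional lines contribute at most \<open>3 * n\<close>, which raises the
    constant from 3 to 6.\<close>
  moreover have "real n \<le> real n powr (11 / 6)"
    using n powr_mono[of 1 "11 / 6" "real n"] by simp
  moreover have "card R \<le> card R1 + card R2 + card R3 + card Q"
  proof -
    have "card R \<le> card (R1 \<union> R2 \<union> R3 \<union> Q)"
      using cover R1 R2 R3 finQ by (intro card_mono) auto
    also have "\<dots> \<le> card (R1 \<union> R2 \<union> R3) + card Q"
      by (rule card_Un_le)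
    finally show ?thesis
      using card_Un_le[of "R1 \<union> R2" R3] card_Un_le[of R1 R2] by linarith
  qed
  moreover have "finite R"
    using cover R1 R2 R3 finQ by (auto intro: finite_subset)
  ultimately show ?thesis
    using R1 R2 R3 unfolding R_def by linarith
qed

text \<open>A vector outside the three spans has at least two nonzero coordinates. Permuting
  \<open>i\<close>, \<open>j\<close>, \<open>k\<close> moves these to the first two places, as the
  coordinate version demands.\<close>

lemma rich_points_bound_noncollinear:
  fixes e :: "'i \<Rightarrow> real ^ 3"
  assumes pencil: "\<And>s. s \<in> {i, j, k, m} \<Longrightarrow> n_pencil n (span {e s}) (L s)"
    and ind: "independent {e i, e j, e k}" and dist: "e i \<noteq> e j" "e i \<noteq> e k" "e j \<noteq> e k"
    and em: "e m \<notin> span {e i}" "e m \<notin> span {e j}" "e m \<notin> span {e k}"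
  shows "finite (rich_points {i, j, k, m} L) \<and>
    real (card (rich_points {i, j, k, m} L)) \<le> 6 * real n powr (11 / 6)"
proof -
  obtain a b c where eq: "e m = a *\<^sub>R e i + b *\<^sub>R e j + c *\<^sub>R e k"
    using coordinate_functionals[OF ind dist] by metis
  then consider "a \<noteq> 0" "b \<noteq> 0" | "a \<noteq> 0" "c \<noteq> 0" | "b \<noteq> 0" "c \<noteq> 0"
    using em by (cases "a = 0"; cases "b = 0"; cases "c = 0") (auto simp: span_singleton)
  then show ?thesis
  proof cases
    case 1
    then show ?thesis
      using rich_points_bound_coordinates[OF pencil ind dist eq] by simp
  next
    case 2
    have "e m = a *\<^sub>R e i + c *\<^sub>R e k + b *\<^sub>R e j" using eq by simp
    then show ?thesis
      using rich_points_bound_coordinates[of i k j m n e L a c b] pencil ind dist 2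
      by (simp add: insert_commute)
  next
    case 3
    have "e m = b *\<^sub>R e j + c *\<^sub>R e k + a *\<^sub>R e i" using eq by simp
    then show ?thesis
      using rich_points_bound_coordinates[of j k i m n e L b c a] pencil ind dist 3
      by (simp add: insert_commute)
  qed
qed

theorem theorem1:
  "\<exists>C::real. \<forall>(n::nat) (c :: nat \<Rightarrow> (real ^ 3) set) (L :: nat \<Rightarrow> (real ^ 3) set set).
     (\<forall>i \<in> {1..4}. n_pencil n (c i) (L i)) \<and>
     inj_on c {1..4} \<and>
     \<not> proj_collinear (c ` {1..4}) \<longrightarrow>
       finite (rich_points {1..4} L) \<and>
       real (card (rich_points {1..4} L)) \<le> C * real n powr (11 / 6)"
proof (intro exI[of _ 6] allI impI; elim conjE)
  fix n :: nat and c :: "nat \<Rightarrow> (real ^ 3) set" and L :: "nat \<Rightarrow> (real ^ 3) set set"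
  assume pencil: "\<forall>i \<in> {1..4}. n_pencil n (c i) (L i)" and inj: "inj_on c {1..4}"
    and noncol: "\<not> proj_collinear (c ` {1..4})"
  have "\<exists>v. v \<noteq> 0 \<and> c i = span {v}" if "i \<in> {1..4}" for i
    using pencil that proj_pointE[of "c i"] unfolding n_pencil_def by metis
  then obtain e where e: "\<And>i. i \<in> {1..4} \<Longrightarrow> e i \<noteq> 0 \<and> c i = span {e i}"
    by metis
  have notin: "e i \<notin> span {e j}" if ij: "i \<in> {1..4}" "j \<in> {1..4}" "i \<noteq> j" for i j
  proof
    assume "e i \<in> span {e j}"
    then obtain t where t: "e i = t *\<^sub>R e j"
      by (auto simp: span_singleton)
    then have "span {e i} = span {e j}"
      using e[OF ij(1)] span_image_scale[of "{e j}" "\<lambda>_. t"] by auto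
    then show False
      using e ij inj by (metis inj_onD)
  qed
  have neq: "e i \<noteq> e j" if "i \<in> {1..4}" "j \<in> {1..4}" "i \<noteq> j" for i j
    using notin[OF that] span_base[of "e j" "{e j}"] by auto
  have ind2: "independent {e 1, e 2}"
    using notin[of 1 2] e[of 2] by (simp add: independent_insert)
  have ind3: "independent {e 1, e 2, v}" if "v \<notin> span {e 1, e 2}" for v
    using independent_insertI[OF that ind2] by (simp add: insert_commute)
  \<comment> \<open>The two enumerations differ in which of the pencils 3 and 4 takes the role of
    \<open>m\<close>.\<close>
  have set: "{1..4} = {1, 2, 3, 4 :: nat}" "{1..4} = {1, 2, 4, 3 :: nat}" by auto
  show "finite (rich_points {1..4} L) \<and> real (card (rich_points {1..4} L)) \<le> 6 * real n powr (11 / 6)"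
  proof (cases "e 3 \<in> span {e 1, e 2}")
    case False
    show ?thesis
      unfolding set(1)
      by (rule rich_points_bound_noncollinear[where e = e])
        (use pencil e ind3[OF False] neq notin in auto)
  next
    case True
    \<comment> \<open>Centre 3 lies on the line joining centres 1 and 2, so centre 4 cannot. Hence
      1, 2, 4 form the reference triangle.\<close>
    have "e 4 \<notin> span {e 1, e 2}"
    proof
      assume "e 4 \<in> span {e 1, e 2}"
      then have "e i \<in> span {e 1, e 2}" if "i \<in> {1..4}" for i
        using True that unfolding set(1) by (auto intro: span_base)
      then have "c i \<subseteq> span {e 1, e 2}" if "i \<in> {1..4}" for i
        using e[OF that] that by (auto simp: span_singleton intro: span_scale)
      moreover have "span {e 1, e 2} \<in> proj_lines"
        using ind2 neq[of 1 2] by (simp add: proj_lines_def dim_eq_card_independent)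
      ultimately show False
        using noncol unfolding proj_collinear_def by blast
    qed
    then show ?thesis
      unfolding set(2)
      by (intro rich_points_bound_noncollinear[where e = e])
        (use pencil e ind3 neq notin in auto)
  qed
qed

end
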